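(* Let $\ell\in\mathbb{N}_0=\{0,1,2,\ldots\}$ and let $\nu\in\mathbb{C}$ with $\operatorname{Re}\nu>-\tfrac12$. Let $z\in\mathbb{C}\setminus(-\infty,0]$ if $\nu\notin\mathbb{N}_0$, and $z\in\mathbb{C}$ if $\nu\in\mathbb{N}_0$. Then the Bessel function of the first kind satisfies $$J_{\nu+\ell}(z)=(-\mathrm{i})^\ell\int_{-\pi}^{\pi}\mathfrak{J}^{(\nu)}_z(\theta)\,e^{\mathrm{i}\ell\theta}\,\mathrm{d}\theta ,$$ where the $2\pi$-periodic function $\mathfrak{J}^{(\nu)}_z$ is given for $\theta\in(-\pi,\pi]$ by $$\mathfrak{J}^{(\nu)}_z(\theta)=\frac{\mathrm{i}^\nu}{2\pi}\,e^{\mathrm{i}\nu[\theta-\pi\operatorname{sgn}(\theta)]}\,e^{\mathrm{i}z\cos\theta}\,P\big(\{\nu\},-\mathrm{i}z(1-\cos\theta)\big).$$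
   Context: $J_\mu(z)=\left(\frac z2\right)^\mu\sum_{k=0}^\infty\frac{(-1)^k(z/2)^{2k}}{k!\,\Gamma(\mu+k+1)}$ is the Bessel function of the first kind, with the principal branch of the power. $\operatorname{sgn}$ is the sign function, and $\mathrm{i}^\nu=e^{\mathrm{i}\pi\nu/2}$. The complex fractional part of $\nu$ is $\{\nu\}=\nu-[\operatorname{Re}\nu]$, where for real $x$, $[x]=\lfloor x\rfloor$ if $x\ge 0$ and $[x]=\lceil x\rceil$ if $x<0$. $P(a,w)=\gamma(a,w)/\Gamma(a)$ is the regularized lower incomplete gamma function, where $\gamma(a,w)=\int_0^w t^{a-1}e^{-t}\,\mathrm{d}t$ for $\operatorname{Re}a>0$. It is extended analytically to other $a$ by $P(a,w)=w^a\gamma^*(a,w)$, where $\gamma^*(a,w)=e^{-w}\sum_{n=0}^\infty\frac{w^n}{\Gamma(a+n+1)}$ is entire in both $a$ and $w$ (with $1/\Gamma=0$ at the poles of $\Gamma$). In particular $P(0,w)=1$. Branch convention: the power of $-\mathrm{i}z(1-\cos\theta)$ contained in $P$ is taken with the phase of $-\mathrm{i}z$ equal to $\operatorname{ph}z-\pi/2$, where $\operatorname{ph}z\in(-\pi,\pi)$ is principal. Equivalently, $$\mathrm{i}^\nu P(\{\nu\},-\mathrm{i}z(1-\cos\theta))=\mathrm{i}^{[\operatorname{Re}\nu]}z^{\{\nu\}}(1-\cos\theta)^{\{\nu\}}\gamma^*(\{\nu\},-\mathrm{i}z(1-\cos\theta)),$$ with the principal branch of $z^{\{\nu\}}$. 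*)

theory Defs
  imports "HOL-Analysis.Analysis"
begin

(* The principal power; differs from powr only in that 0 to the power 0 is 1 (powr has 0). *)
definition cpow :: "complex \<Rightarrow> complex \<Rightarrow> complex" where
  "cpow z a = (if a = 0 then 1 else z powr a)"

definition bessel_J :: "complex \<Rightarrow> complex \<Rightarrow> complex" where
  "bessel_J \<mu> z = cpow (z / 2) \<mu> *
     (\<Sum>k. (-1) ^ k * (z / 2) ^ (2 * k) / fact k * rGamma (\<mu> + of_nat k + 1))"

definition trunc :: "real \<Rightarrow> int" where
  "trunc x = (if x \<ge> 0 then \<lfloor>x\<rfloor> else \<lceil>x\<rceil>)"

definition cfrac :: "complex \<Rightarrow> complex" where
  "cfrac \<nu> = \<nu> - of_int (trunc (Re \<nu>))"

definition gamma_star :: "complex \<Rightarrow> complex \<Rightarrow> complex" where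
  "gamma_star a w = exp (- w) * (\<Sum>n. w ^ n * rGamma (a + of_nat n + 1))"

(* The regularized lower incomplete gamma function P(a,w) = w^a gamma_star(a,w) is multivalued
   in w; the third argument is the phase of w that selects the value of the power w^a. *)
definition reg_lower_gamma :: "complex \<Rightarrow> complex \<Rightarrow> real \<Rightarrow> complex" where
  "reg_lower_gamma a w \<phi> =
     cpow (of_real (norm w)) a * exp (\<i> * a * of_real \<phi>) * gamma_star a w"

(* The representative of \<theta> modulo 2 pi in the half-open interval (-pi, pi]. *)
definition ang :: "real \<Rightarrow> real" where
  "ang \<theta> = \<theta> - 2 * pi * of_int \<lceil>(\<theta> - pi) / (2 * pi)\<rceil>"

(* 1 - cos \<theta> is nonnegative, so the argument of P carries the phase of -iz, which is taken
   to be ph z - pi/2. *)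
definition bessel_kernel :: "complex \<Rightarrow> complex \<Rightarrow> real \<Rightarrow> complex" where
  "bessel_kernel \<nu> z \<theta> = (let t = ang \<theta> in
     exp (\<i> * of_real pi * \<nu> / 2) / (2 * of_real pi)
     * exp (\<i> * \<nu> * of_real (t - pi * sgn t))
     * exp (\<i> * z * of_real (cos t))
     * reg_lower_gamma (cfrac \<nu>) (- \<i> * z * of_real (1 - cos t)) (Arg z - pi / 2))"

lemma ang_eq:
  assumes "-pi < \<theta>" "\<theta> \<le> pi"
  shows "ang \<theta> = \<theta>"
proof -
  have "\<lceil>(\<theta> - pi) / (2 * pi)\<rceil> = 0"
    using assms by (intro ceiling_unique) (auto simp: field_simps)
  then show ?thesis by (simp add: ang_def)
qed

lemma bessel_kernel_periodic: "bessel_kernel \<nu> z (\<theta> + 2 * pi) = bessel_kernel \<nu> z \<theta>"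
proof -
  have "(\<theta> + 2 * pi - pi) / (2 * pi) = (\<theta> - pi) / (2 * pi) + 1"
    by (simp add: field_simps)
  then have "ang (\<theta> + 2 * pi) = ang \<theta>"
    by (simp only: ang_def ceiling_add_one) (simp add: algebra_simps)
  then show ?thesis by (simp add: bessel_kernel_def)
qed

lemma reg_lower_gamma_principal:
  "w \<noteq> 0 \<Longrightarrow> reg_lower_gamma a w (Arg w) = w powr a * gamma_star a w"
  by (simp add: reg_lower_gamma_def cpow_def powr_def Ln_of_real Ln_Arg ring_distribs
      exp_add mult_ac)

lemma gamma_star_0: "gamma_star 0 w = 1"
proof -
  have "(\<lambda>n. w ^ n /\<^sub>R fact n) sums exp w"
    by (rule exp_converges)
  moreover have "w ^ n * rGamma (0 + of_nat n + 1) = w ^ n /\<^sub>R fact n" for n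
  proof -
    have "Gamma (0 + of_nat n + 1 :: complex) = fact n"
      using Gamma_fact[of n, where ?'a = complex] by (simp add: add.commute)
    then show ?thesis by (simp add: rGamma_inverse_Gamma scaleR_conv_of_real mult.commute)
  qed
  ultimately have "(\<Sum>n. w ^ n * rGamma (0 + of_nat n + 1)) = exp w"
    by (metis (no_types, lifting) sums_unique suminf_cong)
  then show ?thesis by (simp add: gamma_star_def exp_minus)
qed

lemma reg_lower_gamma_0: "reg_lower_gamma 0 w \<phi> = 1"
  by (simp add: reg_lower_gamma_def cpow_def gamma_star_0)

lemma reg_lower_gamma_phase:
  assumes "z \<noteq> 0" "cos t \<noteq> 1"
  shows "exp (\<i> * of_real pi * \<nu> / 2)
           * reg_lower_gamma (cfrac \<nu>) (- \<i> * z * of_real (1 - cos t)) (Arg z - pi / 2)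
       = \<i> powi trunc (Re \<nu>) * z powr cfrac \<nu> * of_real (1 - cos t) powr cfrac \<nu>
           * gamma_star (cfrac \<nu>) (- \<i> * z * of_real (1 - cos t))"
proof -
  define a c where "a = cfrac \<nu>" and "c = 1 - cos t"
  have c: "c > 0" using assms(2) cos_le_one[of t] by (simp add: c_def less_le)
  have nu: "\<nu> = a + of_int (trunc (Re \<nu>))" by (simp add: a_def cfrac_def)
  have n: "norm (- \<i> * z * of_real c) = norm z * c" using c by (simp add: norm_mult)
  have i: "\<i> powi m = exp (\<i> * of_real pi * of_int m / 2)" for m :: int
  proof -
    have "\<i> = exp (\<i> * of_real pi / 2)" by (simp add: exp_eq_polar cis_conv_exp[symmetric])
    then have "\<i> powi m = exp (\<i> * of_real pi / 2) powi m" by simp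
    also have "\<dots> = exp (of_int m * (\<i> * of_real pi / 2))" by (simp add: exp_power_int)
    finally show ?thesis by (simp add: mult_ac)
  qed
  have "exp (\<i> * of_real pi * \<nu> / 2) * (cpow (of_real (norm z * c)) a * exp (\<i> * a * of_real (Arg z - pi / 2)))
      = \<i> powi trunc (Re \<nu>) * z powr a * of_real c powr a"
    using c assms(1) n
    by (subst nu) (simp add: i norm_mult cpow_def powr_def Ln_of_real Ln_Arg ln_mult
        exp_add[symmetric] ring_distribs add_divide_distrib mult_ac add_ac)
  then show ?thesis
    by (simp only: reg_lower_gamma_def a_def[symmetric] c_def[symmetric] n) (metis mult.assoc)
qed

end

theory Submission
  imports Defs "HOL-Complex_Analysis.Cauchy_Integral_Formula" "HOL-Real_Asymp.Real_Asymp"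
begin

text \<open>
Writing the argument of the cosine as twice an angle x in the interval from -pi/2 to pi/2
(with theta = 2x + pi or theta = 2x - pi), 1 - cos theta becomes 2 cos^2 x, and the factor
exp (-w) of the incomplete gamma function combines with exp (i z cos theta) to exp (i z). So the
kernel is a series in n of powers cos^(2a+2n) x times a single exponential exp (2i mu x), where
a is the fractional part of nu and mu = nu + l. The integrals of the terms are Cauchy's integrals of
cos^p x exp (iqx); as (p - q)/2 is an integer, recurrences reduce them to the case p = q, which is
the mean value property of (1 - u)^p. The terms with n < mu - a vanish, and the rest is a confluent
hypergeometric series, which Kummer's second formula turns into the Bessel series.
\<close>

subsection \<open>Cauchy's cosine integral\<close>

text \<open>For negative \<open>r\<close> the function is unbounded near both endpoints. It serves
  below as the majorant of every integrand.\<close>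

lemma cos_powr_integrable:
  fixes r :: real
  assumes r: "r > -1"
  shows "(\<lambda>x. cos x powr r) integrable_on {-pi/2..pi/2}"
proof -
  have cont: "continuous_on {-pi/2..pi/2} (\<lambda>x. cos x powr s)" if "s > 0" for s
    using that by (intro continuous_on_powr' continuous_intros) (auto simp: cos_ge_zero)
  txt \<open>The derivative of cos^(r+1) sin relates cos^r to the continuous function cos^(r+2).\<close>
  let ?D = "\<lambda>x. (r + 2) * cos x powr (r + 2) - (r + 1) * cos x powr r"
  have "(?D has_integral (cos (pi/2) powr (r + 1) * sin (pi/2) - cos (-pi/2) powr (r + 1) * sin (-pi/2)))
          {-pi/2..pi/2}"
  proof (rule fundamental_theorem_of_calculus_interior)
    show "continuous_on {-pi/2..pi/2} (\<lambda>x. cos x powr (r + 1) * sin x)"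
      using r by (intro continuous_intros cont) auto
    fix x :: real assume x: "x \<in> {-pi/2<..<pi/2}"
    then have c: "cos x > 0" by (simp add: cos_gt_zero_pi)
    have "((\<lambda>x. cos x powr (r + 1) * sin x) has_real_derivative
        ((r + 1) * cos x powr (r + 1 - of_nat 1) * (- sin x) * sin x + cos x * cos x powr (r + 1))) (at x)"
      by (intro DERIV_mult DERIV_fun_powr DERIV_cos DERIV_sin c)
    also have "(r + 1) * cos x powr (r + 1 - of_nat 1) * (- sin x) * sin x + cos x * cos x powr (r + 1)
        = (cos x)\<^sup>2 * cos x powr r - (r + 1) * (sin x)\<^sup>2 * cos x powr r"
      using c by (simp add: powr_add power2_eq_square algebra_simps)
    also have "\<dots> = ?D x"
      using c unfolding sin_squared_eq by (simp add: powr_add algebra_simps)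
    finally have "((\<lambda>x. cos x powr (r + 1) * sin x) has_real_derivative ?D x) (at x)" .
    then show "((\<lambda>x. cos x powr (r + 1) * sin x) has_vector_derivative ?D x) (at x)"
      by (simp add: has_real_derivative_iff_has_vector_derivative)
  qed auto
  then have "?D integrable_on {-pi/2..pi/2}" by blast
  moreover have "(\<lambda>x. (r + 2) * cos x powr (r + 2)) integrable_on {-pi/2..pi/2}"
    using r by (intro integrable_continuous_real continuous_intros cont) auto
  ultimately have "(\<lambda>x. (r + 2) * cos x powr (r + 2) - ?D x) integrable_on {-pi/2..pi/2}"
    by (rule integrable_diff[rotated])
  then have "(\<lambda>x. (1 / (r + 1)) *\<^sub>R ((r + 1) * cos x powr r)) integrable_on {-pi/2..pi/2}"
    by (intro integrable_cmul) simp
  then show ?thesis using r by simp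
qed

section \<open>The integrals of cos^p x exp (iqx) and their recurrences\<close>

definition cos_kernel :: "complex \<Rightarrow> complex \<Rightarrow> real \<Rightarrow> complex" where
  "cos_kernel p q x = of_real (cos x) powr p * exp (\<i> * q * of_real x)"

text \<open>The modulus of exp (iqx) is exp (-x Im q), and x is at most pi/2 in modulus. The bound
  involves \<open>p\<close> only through a power of cos x, so one bound will serve a whole series
  with growing exponents.\<close>

lemma norm_cos_kernel_le:
  assumes "x \<in> {-pi/2..pi/2}"
  shows "norm (cos_kernel p q x) \<le> exp (\<bar>Im q\<bar> * (pi / 2)) * cos x powr Re p"
proof -
  have "- (Im q * x) \<le> \<bar>Im q\<bar> * \<bar>x\<bar>"
    by (metis abs_ge_minus_self abs_mult)
  also have "\<dots> \<le> \<bar>Im q\<bar> * (pi / 2)"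
    using assms by (intro mult_left_mono) auto
  finally have "norm (exp (\<i> * q * of_real x)) \<le> exp (\<bar>Im q\<bar> * (pi / 2))" by simp
  moreover have "norm (of_real (cos x) powr p :: complex) = cos x powr Re p"
    using assms by (subst norm_powr_real_powr) (auto simp: cos_ge_zero)
  ultimately show ?thesis
    unfolding cos_kernel_def norm_mult by (subst mult.commute) (intro mult_mono, auto)
qed

lemma cos_kernel_measurable [measurable]: "cos_kernel p q \<in> borel_measurable borel"
  unfolding cos_kernel_def powr_def by measurable

lemma cos_kernel_absolutely_integrable:
  assumes "Re p > -1"
  shows "cos_kernel p q absolutely_integrable_on {-pi/2..pi/2}"
proof (rule measurable_bounded_by_integrable_imp_absolutely_integrable)
  have "cos_kernel p q \<in> borel_measurable lebesgue"
    by (simp add: measurable_completion)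
  then show "cos_kernel p q \<in> borel_measurable (lebesgue_on {-pi/2..pi/2})"
    by (rule measurable_restrict_space1)
  show "(\<lambda>x. exp (\<bar>Im q\<bar> * (pi / 2)) * cos x powr Re p) integrable_on {-pi/2..pi/2}"
    using integrable_cmul[OF cos_powr_integrable[OF assms], of "exp (\<bar>Im q\<bar> * (pi / 2))"] by simp
qed (use norm_cos_kernel_le in auto)

lemma cos_kernel_integrable:
  "Re p > -1 \<Longrightarrow> cos_kernel p q integrable_on {-pi/2..pi/2}"
  using cos_kernel_absolutely_integrable set_lebesgue_integral_eq_integral(1) by blast

text \<open>This holds also where cos x = 0, because \<open>powr\<close> with base 0 is 0 for every
  exponent.\<close>

lemma cos_kernel_shift:
  "cos_kernel (p + 1) q x = cos_kernel p q x * of_real (cos x)"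
  by (cases "cos x = 0") (simp_all add: cos_kernel_def powr_add)

text \<open>The integrand is the derivative of \<open>cos_kernel (p + 1) q\<close>, which vanishes
  at both endpoints. It may blow up there when Re p < 0, hence the interior form of the fundamental
  theorem.\<close>

lemma has_integral_deriv_cos_kernel:
  assumes p: "Re p > -1"
  shows "((\<lambda>x. cos_kernel p q x * (\<i> * q * of_real (cos x) - (p + 1) * of_real (sin x)))
           has_integral 0) {-pi/2..pi/2}"
proof -
  have "((\<lambda>x. cos_kernel p q x * (\<i> * q * of_real (cos x) - (p + 1) * of_real (sin x)))
          has_integral (cos_kernel (p + 1) q (pi/2) - cos_kernel (p + 1) q (-pi/2))) {-pi/2..pi/2}"
  proof (rule fundamental_theorem_of_calculus_interior)
    have "p + 1 \<noteq> 0" using p by (auto simp: complex_eq_iff)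
    then show "continuous_on {-pi/2..pi/2} (cos_kernel (p + 1) q)"
      unfolding cos_kernel_def using p
      by (intro continuous_on_mult continuous_on_powr_complex continuous_intros) (auto simp: cos_ge_zero)
    fix x :: real assume x: "x \<in> {-pi/2<..<pi/2}"
    then have c: "cos x > 0" by (simp add: cos_gt_zero_pi)
    then have c': "cos (complex_of_real x) \<notin> \<real>\<^sub>\<le>\<^sub>0" "cos (complex_of_real x) \<noteq> 0"
      by (auto simp: cos_of_real)
    have "((\<lambda>w. cos w powr (p + 1) * exp (\<i> * q * w)) has_field_derivative
            cos_kernel p q x * (\<i> * q * of_real (cos x) - (p + 1) * of_real (sin x))) (at (of_real x))"
      using c'
      by (auto intro!: derivative_eq_intros
            simp: cos_kernel_def powr_add sin_of_real cos_of_real powr_diff field_simps)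
    from has_vector_derivative_real_field[OF this]
    show "(cos_kernel (p + 1) q has_vector_derivative
            cos_kernel p q x * (\<i> * q * of_real (cos x) - (p + 1) * of_real (sin x))) (at x)"
      by (simp add: cos_kernel_def[abs_def] o_def cos_of_real)
  qed auto
  then show ?thesis by (simp add: cos_kernel_def)
qed

definition cos_integral :: "complex \<Rightarrow> complex \<Rightarrow> complex" where
  "cos_integral p q = integral {-pi/2..pi/2} (cos_kernel p q)"

text \<open>Eliminating sin x by exp (ix) = cos x + i sin x turns the vanishing integral into a
  recurrence. It keeps the sum of the two parameters and changes their difference by 2.\<close>

lemma cos_integral_up:
  assumes p: "Re p > -1"
  shows "(p + 1) * cos_integral p (q + 1) = (p + 1 - q) * cos_integral (p + 1) q"
proof -
  have eq: "cos_kernel p q x * (\<i> * q * of_real (cos x) - (p + 1) * of_real (sin x))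
      = \<i> * ((p + 1) * cos_kernel p (q + 1) x - (p + 1 - q) * cos_kernel (p + 1) q x)" for x
  proof -
    have "cos_kernel p (q + 1) x = cos_kernel p q x * exp (\<i> * of_real x)"
      by (simp add: cos_kernel_def ring_distribs exp_add)
    also have "exp (\<i> * of_real x) = of_real (cos x) + \<i> * of_real (sin x)"
      by (simp add: exp_Euler cos_of_real sin_of_real)
    finally show ?thesis
      by (simp only: cos_kernel_shift) (simp add: algebra_simps)
  qed
  have "((\<lambda>x. \<i> * ((p + 1) * cos_kernel p (q + 1) x - (p + 1 - q) * cos_kernel (p + 1) q x))
      has_integral \<i> * ((p + 1) * cos_integral p (q + 1) - (p + 1 - q) * cos_integral (p + 1) q))
      {-pi/2..pi/2}"
    unfolding cos_integral_def using p
    by (intro has_integral_mult_right has_integral_diff integrable_integral cos_kernel_integrable) auto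
  from has_integral_unique[OF this has_integral_deriv_cos_kernel[OF p, of q, unfolded eq]]
  show ?thesis by simp
qed

text \<open>The same elimination with exp (-ix) gives a recurrence that keeps the difference of the
  two parameters.\<close>

lemma cos_integral_down:
  assumes p: "Re p > -1"
  shows "(p + 1) * cos_integral p (q - 1) = (p + 1 + q) * cos_integral (p + 1) q"
proof -
  have eq: "cos_kernel p q x * (\<i> * q * of_real (cos x) - (p + 1) * of_real (sin x))
      = \<i> * ((p + 1 + q) * cos_kernel (p + 1) q x - (p + 1) * cos_kernel p (q - 1) x)" for x
  proof -
    have "cos_kernel p (q - 1) x = cos_kernel p q x * exp (-(\<i> * of_real x))"
      by (simp add: cos_kernel_def ring_distribs exp_add exp_diff exp_minus field_simps)
    also have "exp (-(\<i> * of_real x)) = of_real (cos x) - \<i> * of_real (sin x)"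
      using exp_Euler[of "-of_real x"] by (simp add: cos_of_real sin_of_real)
    finally show ?thesis
      by (simp only: cos_kernel_shift) (simp add: algebra_simps)
  qed
  have "((\<lambda>x. \<i> * ((p + 1 + q) * cos_kernel (p + 1) q x - (p + 1) * cos_kernel p (q - 1) x))
      has_integral \<i> * ((p + 1 + q) * cos_integral (p + 1) q - (p + 1) * cos_integral p (q - 1)))
      {-pi/2..pi/2}"
    unfolding cos_integral_def using p
    by (intro has_integral_mult_right has_integral_diff integrable_integral cos_kernel_integrable) auto
  from has_integral_unique[OF this has_integral_deriv_cos_kernel[OF p, of q, unfolded eq]]
  show ?thesis by simp
qed

text \<open>Cauchy's formula at the centre of the unit disc for (1 - u)^p, whose value there is 1.
  On the circle put u = -exp (2ix); then 1 - u = 2 cos x exp (ix). The condition Re p > 0 gives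
  continuity at u = 1.\<close>

lemma cos_integral_diag_pos:
  assumes p: "Re p > 0"
  shows "cos_integral p p = of_real pi / 2 powr p"
proof -
  have "((\<lambda>u. (1 - u) powr p / (u - 0)) has_contour_integral
           (2 * of_real pi * \<i> * (1 - 0) powr p)) (circlepath 0 1)"
  proof (rule Cauchy_integral_circlepath)
    \<comment> \<open>Thus 1 - u stays in the closed right half plane, away from the cut of the
      principal power except at 0.\<close>
    have re: "Re w \<le> 1" if "norm w \<le> 1" for w :: complex
      using complex_Re_le_cmod[of w] that by linarith
    show "continuous_on (cball 0 1) (\<lambda>u. (1 - u) powr p)"
      using p re by (intro continuous_on_powr_complex continuous_intros) auto
    have "1 - u \<notin> \<real>\<^sub>\<le>\<^sub>0" if "norm u < 1" for u :: complex
      using complex_Re_le_cmod[of u] that by (auto simp: complex_nonpos_Reals_iff)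
    then show "(\<lambda>u. (1 - u) powr p) holomorphic_on ball 0 1"
      by (intro holomorphic_intros) auto
  qed simp
  then have "((\<lambda>x. (1 - exp (2 * of_real pi * \<i> * of_real x)) powr p * (2 * of_real pi * \<i>))
      has_integral (2 * of_real pi * \<i>)) {0..1}"
    by (simp add: has_contour_integral vector_derivative_circlepath) (simp add: circlepath mult.assoc)
  moreover have nz: "2 * of_real pi * \<i> \<noteq> 0" by simp
  ultimately have "((\<lambda>x. (1 - exp (2 * of_real pi * \<i> * of_real x)) powr p * (2 * of_real pi * \<i>)
      * inverse (2 * of_real pi * \<i>)) has_integral (2 * of_real pi * \<i> * inverse (2 * of_real pi * \<i>))) {0..1}"
    by (intro has_integral_mult_left)
  then have "((\<lambda>x. (1 - exp (2 * of_real pi * \<i> * of_real x)) powr p) has_integral 1) {0..1}"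
    by (simp only: mult.assoc[of _ "2 * of_real pi * \<i>"] right_inverse[OF nz] mult_1_right)
  \<comment> \<open>The circle parameter is x/pi + 1/2, which puts the critical point u = 1 at the
    two endpoints of the x-interval.\<close>
  from has_integral_affinity[of _ _ "0::real" 1 "1/pi" "1/2", unfolded cbox_interval, OF this]
  have circ: "((\<lambda>x. (1 - exp (2 * of_real pi * \<i> * of_real ((1/pi) *\<^sub>R x + 1/2))) powr p)
      has_integral of_real pi) {-pi/2..pi/2}"
    by (simp add: image_affinity_atLeastAtMost_diff scaleR_conv_of_real)
  have eq: "(1 - exp (2 * of_real pi * \<i> * of_real ((1/pi) *\<^sub>R x + 1/2))) powr p
      = 2 powr p * cos_kernel p p x" if x: "x \<in> {-pi/2..pi/2} - {-pi/2, pi/2}" for x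
  proof -
    have c: "cos x > 0" using x by (intro cos_gt_zero_pi) auto
    have "exp (2 * of_real pi * \<i> * of_real ((1/pi) *\<^sub>R x + 1/2)) = - (exp (\<i> * of_real x)
        * exp (\<i> * of_real x))"
    proof -
      have "2 * of_real pi * \<i> * of_real ((1/pi) *\<^sub>R x + 1/2)
          = \<i> * of_real x + \<i> * of_real x + \<i> * of_real pi"
        by (simp add: field_simps)
      then show ?thesis by (simp only: exp_add) simp
    qed
    also have "1 - \<dots> = of_real (2 * cos x) * exp (\<i> * of_real x)"
    proof -
      have "of_real (2 * cos x) = exp (\<i> * of_real x) + exp (-(\<i> * of_real x))"
        by (simp add: cos_exp_eq flip: cos_of_real)
      then show ?thesis by (simp add: ring_distribs exp_minus)
    qed
    \<comment> \<open>The power splits because one factor is a positive real; afterwards Ln (exp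
      (ix)) = ix, as x lies strictly between -pi/2 and pi/2.\<close>
    also have "\<dots> powr p = of_real (2 * cos x) powr p * exp (\<i> * of_real x) powr p"
      using c by (intro powr_times_real_left) auto
    also have "\<dots> = 2 powr p * of_real (cos x) powr p * exp (\<i> * p * of_real x)"
    proof -
      have "of_real (2 * cos x) powr p = 2 powr p * of_real (cos x) powr p"
        using powr_times_real_left[of 2 "of_real (cos x)" p] by simp
      moreover have "exp (\<i> * of_real x) powr p = exp (\<i> * p * of_real x)"
        using x by (simp add: powr_def Ln_exp mult_ac)
      ultimately show ?thesis by simp
    qed
    finally show ?thesis by (simp add: cos_kernel_def)
  qed
  have "((\<lambda>x. 2 powr p * cos_kernel p p x) has_integral of_real pi) {-pi/2..pi/2}"
    by (rule has_integral_spike_finite[of "{-pi/2, pi/2}", OF _ eq[symmetric] circ]) auto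
  then have "2 powr p * cos_integral p p = of_real pi"
    by (simp add: cos_integral_def integral_unique flip: integral_mult_right)
  then show ?thesis by (simp add: field_simps)
qed

text \<open>One step of \<open>cos_integral_down\<close> along the diagonal extends the formula from
  Re p > 0 to Re p > -1.\<close>

lemma cos_integral_diag:
  assumes p: "Re p > -1"
  shows "cos_integral p p = of_real pi / 2 powr p"
proof -
  have "p + 1 \<noteq> 0" using p by (auto simp: complex_eq_iff)
  moreover have "(p + 1) * cos_integral p p = (p + 1) * (2 * cos_integral (p + 1) (p + 1))"
    using cos_integral_down[OF p, of "p + 1"] by (simp add: algebra_simps)
  ultimately have "cos_integral p p = 2 * cos_integral (p + 1) (p + 1)" by simp
  also have "\<dots> = of_real pi / 2 powr p"
    using p by (simp add: cos_integral_diag_pos powr_add)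
  finally show ?thesis .
qed

text \<open>In \<open>cos_integral_up\<close> with q = p + 1 the factor p + 1 - q is 0, which
  settles the difference 2. Each further step lowers the difference by 2 while raising
  \<open>p\<close> by 1, so \<open>p\<close> must be arbitrary in the induction.\<close>

lemma cos_integral_zero:
  assumes "Re p > -1"
  shows "cos_integral p (p + 2 * of_nat (Suc j)) = 0"
  using assms
proof (induction j arbitrary: p)
  case 0
  then have "p + 1 \<noteq> 0" by (auto simp: complex_eq_iff)
  with cos_integral_up[of p "p + 1"] 0 show ?case by (simp add: add.assoc)
next
  case (Suc j)
  then have p: "p + 1 \<noteq> 0" by (auto simp: complex_eq_iff)
  have "cos_integral (p + 1) (p + 1 + 2 * of_nat (Suc j)) = 0"
    using Suc.prems by (intro Suc.IH) simp
  with cos_integral_up[of p "p + 1 + 2 * of_nat (Suc j)"] Suc.prems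
  have "(p + 1) * cos_integral p (p + 1 + 2 * of_nat (Suc j) + 1) = 0" by simp
  then have "cos_integral p (p + 1 + 2 * of_nat (Suc j) + 1) = 0"
    using p by (simp only: mult_eq_0_iff) simp
  then show ?case by (simp add: algebra_simps)
qed

text \<open>Induction from the diagonal: \<open>cos_integral_up\<close> reduces \<open>Suc k\<close>
  at \<open>q\<close> to \<open>k\<close> at \<open>q + 1\<close>, with p + 1 - q = 2(k + 1)
  supplying the new factors of 2 and of the factorial.\<close>

lemma cos_integral_Gamma:
  assumes "Re q > -1"
  shows "cos_integral (q + 2 * of_nat k) q =
    of_real pi * Gamma (q + 2 * of_nat k + 1) / (2 powr (q + 2 * of_nat k)) * rGamma (q + of_nat k + 1) / fact k"
  using assms
proof (induction k arbitrary: q)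
  case 0
  then have "q + 1 \<notin> \<int>\<^sub>\<le>\<^sub>0" by (auto elim!: nonpos_Ints_cases simp: complex_eq_iff)
  then show ?case using 0
    by (simp add: cos_integral_diag rGamma_inverse_Gamma Gamma_eq_zero_iff)
next
  case (Suc k)
  let ?p = "q + 2 * of_nat k + 1"
  have nz: "?p + 1 \<noteq> 0" using Suc.prems by (auto simp: complex_eq_iff)
  have "(2 * of_nat (Suc k)) * cos_integral (q + 2 * of_nat (Suc k)) q
      = (?p + 1) * cos_integral (q + 1 + 2 * of_nat k) (q + 1)"
    using cos_integral_up[of ?p q] Suc.prems by (simp add: algebra_simps)
  also have "\<dots> = (?p + 1) * (of_real pi * Gamma (?p + 1) / (2 powr ?p) * rGamma (q + of_nat (Suc k) + 1) / fact k)"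
    using Suc.prems by (subst Suc.IH) (simp_all add: algebra_simps)
  also have "\<dots> = of_real pi * Gamma (?p + 1 + 1) / (2 powr ?p) * rGamma (q + of_nat (Suc k) + 1) / fact k"
  proof -
    have "?p + 1 \<notin> \<int>\<^sub>\<le>\<^sub>0" using Suc.prems by (auto elim!: nonpos_Ints_cases simp: complex_eq_iff)
    from Gamma_plus1[OF this] show ?thesis by simp
  qed
  also have "\<dots> = (2 * of_nat (Suc k)) * (of_real pi * Gamma (q + 2 * of_nat (Suc k) + 1)
      / (2 powr (q + 2 * of_nat (Suc k))) * rGamma (q + of_nat (Suc k) + 1) / fact (Suc k))"
  proof -
    have e: "q + 2 * of_nat (Suc k) = ?p + 1" by simp
    show ?thesis unfolding e powr_add by (simp add: divide_simps del: of_nat_Suc)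
  qed
  finally show ?case
    by (subst (asm) mult_left_cancel) (simp_all del: of_nat_Suc)
qed

subsection \<open>Kummer's second formula\<close>

text \<open>Ratio test through \<open>rGamma u = u * rGamma (u + 1)\<close>, which is valid at the
  poles of Gamma too. This is the convergence of the series in \<open>gamma_star\<close>.\<close>

lemma summable_rGamma_power: "summable (\<lambda>n. norm (rGamma (a + of_nat n + 1) * w ^ n))" for a w :: complex
proof -
  have lim: "filterlim (\<lambda>n. norm (a + of_nat n + 1)) at_top sequentially"
  proof (rule filterlim_at_top_mono)
    show "filterlim (\<lambda>n. real n - (norm (a + 1))) at_top sequentially"
      by real_asymp
    have "real n - norm (a + 1) \<le> norm (a + of_nat n + 1)" for n
      using norm_triangle_ineq4[of "a + of_nat n + 1" "a + 1"] by simp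
    then show "\<forall>\<^sub>F n in sequentially. real n - norm (a + 1) \<le> norm (a + of_nat n + 1)" by simp
  qed
  then have "\<forall>\<^sub>F n in sequentially. norm (a + of_nat n + 1) \<ge> 2 * norm w + 1"
    by (simp add: filterlim_at_top)
  then obtain N where N: "\<And>n. n \<ge> N \<Longrightarrow> norm (a + of_nat n + 1) \<ge> 2 * norm w + 1"
    by (auto simp: eventually_sequentially)
  show ?thesis
  proof (rule summable_ratio_test[of "1/2" N])
    fix n assume n: "n \<ge> N"
    define u where "u = a + of_nat n + 1"
    have u: "norm u \<ge> 2 * norm w + 1" using N[OF n] by (simp add: u_def)
    have "norm u * norm (rGamma (u + 1)) = norm (rGamma u)"
      by (metis norm_mult rGamma_plus1)
    then have "norm (rGamma (u + 1)) * (2 * norm w) \<le> norm (rGamma u)"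
      using mult_right_mono[OF order.trans[OF _ u], of "2 * norm w" "norm (rGamma (u + 1))"]
      by (simp add: mult_ac)
    from mult_right_mono[OF this, of "norm w ^ n / 2"]
    have "norm (rGamma (u + 1) * w ^ Suc n) \<le> 1/2 * norm (rGamma u * w ^ n)"
      by (simp add: norm_mult norm_power mult_ac)
    then show "norm (norm (rGamma (a + of_nat (Suc n) + 1) * w ^ Suc n))
        \<le> 1/2 * norm (norm (rGamma (a + of_nat n + 1) * w ^ n))"
      by (simp add: u_def add_ac)
  qed simp
qed

text \<open>Up to a constant factor, this is 1F1(c; 2c; -2iz) as a series in z.\<close>

definition kummer_fps :: "complex \<Rightarrow> complex fps" where
  "kummer_fps c = Abs_fps (\<lambda>k. (-2 * \<i>) ^ k * Gamma (c + of_nat k) * rGamma (2 * c + of_nat k) / fact k)"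

lemma kummer_fps_rec:
  assumes "Re c > 0"
  shows "of_nat (Suc k) * (2 * c + of_nat k) * fps_nth (kummer_fps c) (Suc k)
       = -2 * \<i> * (c + of_nat k) * fps_nth (kummer_fps c) k"
proof -
  have "c + of_nat k \<notin> \<int>\<^sub>\<le>\<^sub>0" using assms by (auto elim!: nonpos_Ints_cases simp: complex_eq_iff)
  then have 1: "Gamma (c + of_nat (Suc k)) = (c + of_nat k) * Gamma (c + of_nat k)"
    using Gamma_plus1[of "c + of_nat k"] by (simp add: add_ac)
  have 2: "rGamma (2 * c + of_nat k) = (2 * c + of_nat k) * rGamma (2 * c + of_nat (Suc k))"
    using rGamma_plus1[of "2 * c + of_nat k"] by (simp add: add_ac)
  show ?thesis
    unfolding kummer_fps_def fps_nth_Abs_fps 1 2 by (simp add: field_simps del: of_nat_Suc)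
qed

text \<open>Kummer's equation x y'' + (2c - x) y' - c y = 0 after the substitution x = -2iz, checked
  coefficient by coefficient with the recurrence.\<close>

lemma kummer_fps_ode:
  assumes "Re c > 0"
  defines "F \<equiv> kummer_fps c"
  shows "fps_X * fps_deriv (fps_deriv F) + (fps_const (2 * c) + fps_const (2 * \<i>) * fps_X) * fps_deriv F
     + fps_const (2 * \<i> * c) * F = 0"
proof (rule fps_ext)
  fix k
  show "fps_nth (fps_X * fps_deriv (fps_deriv F) + (fps_const (2 * c) + fps_const (2 * \<i>) * fps_X) * fps_deriv F
     + fps_const (2 * \<i> * c) * F) k = fps_nth 0 k"
  proof -
    have [simp]: "fps_const x * fps_X * g = fps_X * (fps_const x * g)" for x :: complex and g
      by (simp add: mult_ac)
    have "fps_nth (fps_X * fps_deriv (fps_deriv F) + (fps_const (2 * c) + fps_const (2 * \<i>) * fps_X) * fps_deriv F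
        + fps_const (2 * \<i> * c) * F) k
      = of_nat (Suc k) * (2 * c + of_nat k) * fps_nth F (Suc k) - (-2 * \<i> * (c + of_nat k) * fps_nth F k)"
      by (cases k) (auto simp: algebra_simps)
    then show ?thesis unfolding kummer_fps_rec[OF assms(1), folded F_def] by simp
  qed
qed

section \<open>The factor exp (iz) and the even Bessel series\<close>

definition bessel_fps :: "complex \<Rightarrow> complex fps" where
  "bessel_fps c = fps_exp \<i> * kummer_fps c"

text \<open>The exponential removes the term 2iz y' from Kummer's equation. What remains is the
  equation satisfied by z^(1/2 - c) J_(c - 1/2)(z); it links only coefficients whose indices differ
  by 2.\<close>

lemma bessel_fps_ode:
  assumes "Re c > 0"
  defines "Y \<equiv> bessel_fps c"
  shows "fps_X * fps_deriv (fps_deriv Y) + fps_const (2 * c) * fps_deriv Y + fps_X * Y = 0"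
proof -
  define F where "F = kummer_fps c"
  define E where "E = fps_exp \<i>"
  have i: "fps_const \<i> * fps_const \<i> = -1" by (simp add: fps_const_mult fps_const_neg[symmetric] del: fps_const_neg)
  have E: "fps_deriv E = fps_const \<i> * E" by (simp add: E_def)
  have "fps_X * fps_deriv (fps_deriv Y) + fps_const (2 * c) * fps_deriv Y + fps_X * Y
     = E * (fps_X * fps_deriv (fps_deriv F) + (fps_const (2 * c) + fps_const (2 * \<i>) * fps_X) * fps_deriv F
     + fps_const (2 * \<i> * c) * F) + (fps_const \<i> * fps_const \<i> + 1) * fps_X * E * F"
    unfolding Y_def bessel_fps_def F_def[symmetric] E_def[symmetric]
    by (simp add: E algebra_simps flip: fps_const_mult)
  then show ?thesis using kummer_fps_ode[OF assms(1)] i by (simp add: F_def)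
qed

lemma bessel_fps_rec:
  assumes "Re c > 0"
  shows "of_nat (k + 2) * (of_nat (k + 1) + 2 * c) * fps_nth (bessel_fps c) (k + 2) = - fps_nth (bessel_fps c) k"
    and "fps_nth (bessel_fps c) 1 = 0"
proof -
  have *: "fps_nth (fps_X * fps_deriv (fps_deriv (bessel_fps c))
      + fps_const (2 * c) * fps_deriv (bessel_fps c) + fps_X * bessel_fps c) n = 0" for n
    using bessel_fps_ode[OF assms] by simp
  from *[of 0] assms show "fps_nth (bessel_fps c) 1 = 0" by auto
  from *[of "Suc k"]
  show "of_nat (k + 2) * (of_nat (k + 1) + 2 * c) * fps_nth (bessel_fps c) (k + 2) = - fps_nth (bessel_fps c) k"
    by (simp add: algebra_simps add_eq_0_iff)
qed

lemma bessel_fps_odd: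
  assumes "Re c > 0"
  shows "fps_nth (bessel_fps c) (2 * k + 1) = 0"
proof (induction k)
  case 0
  then show ?case using bessel_fps_rec(2)[OF assms] by simp
next
  case (Suc k)
  have "of_nat (2 * k + 1 + 2) * (of_nat (2 * k + 1 + 1) + 2 * c) * fps_nth (bessel_fps c) (2 * k + 1 + 2) = 0"
    unfolding bessel_fps_rec(1)[OF assms] using Suc by simp
  moreover have "of_nat (2 * k + 1 + 2) \<noteq> (0 :: complex)" by (simp only: of_nat_eq_0_iff)
  moreover have "of_nat (2 * k + 1 + 1) + 2 * c \<noteq> 0" using assms by (auto simp: complex_eq_iff)
  ultimately have "fps_nth (bessel_fps c) (2 * k + 1 + 2) = 0" by (simp only: mult_eq_0_iff) auto
  then show ?case by simp
qed

text \<open>The constant term Gamma(c)/Gamma(2c) is rewritten by Legendre's duplication formula,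
  which produces the constant power of 2 and sqrt pi. The two-step recurrence does the rest.\<close>

lemma bessel_fps_even:
  assumes "Re c > 0"
  shows "fps_nth (bessel_fps c) (2 * k) =
     (-1) ^ k / 4 ^ k / fact k * rGamma (c + 1/2 + of_nat k) * (2 powr (1 - 2 * c) * of_real (sqrt pi))"
proof (induction k)
  case 0
  have nz: "c \<notin> \<int>\<^sub>\<le>\<^sub>0" "c + 1/2 \<notin> \<int>\<^sub>\<le>\<^sub>0" "2 * c \<notin> \<int>\<^sub>\<le>\<^sub>0"
    using assms by (auto elim!: nonpos_Ints_cases simp: complex_eq_iff)
  have "fps_nth (bessel_fps c) 0 = Gamma c * rGamma (2 * c)"
    by (simp add: bessel_fps_def kummer_fps_def)
  also have "\<dots> = rGamma (c + 1/2) * (Gamma c * Gamma (c + 1/2)) * rGamma (2 * c)"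
    using nz by (simp add: rGamma_inverse_Gamma Gamma_eq_zero_iff)
  also have "\<dots> = rGamma (c + 1/2) * (2 powr (1 - 2 * c) * of_real (sqrt pi))"
    using nz Ln_of_real[of 2] by (subst Gamma_legendre_duplication)
      (simp_all add: rGamma_inverse_Gamma Gamma_eq_zero_iff powr_def mult_ac)
  finally show ?case by simp
next
  case (Suc k)
  let ?D = "2 powr (1 - 2 * c) * of_real (sqrt pi) :: complex"
  let ?u = "c + 1/2 + of_nat k"
  have nz: "?u \<noteq> 0" using assms by (auto simp: complex_eq_iff)
  have r: "rGamma ?u = ?u * rGamma (c + 1/2 + of_nat (Suc k))"
    using rGamma_plus1[of ?u] by (simp add: add_ac)
  \<comment> \<open>The factor of the recurrence at index 2k is (2k + 2)(2k + 1 + 2c) = 4(k + 1)(c +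
    1/2 + k).\<close>
  have "(4 * of_nat (Suc k) * ?u) * fps_nth (bessel_fps c) (2 * Suc k) = - fps_nth (bessel_fps c) (2 * k)"
    using bessel_fps_rec(1)[OF assms, of "2 * k"] by (simp add: algebra_simps)
  also have "\<dots> = (4 * of_nat (Suc k) * ?u) * ((-1) ^ Suc k / 4 ^ Suc k / fact (Suc k)
      * rGamma (c + 1/2 + of_nat (Suc k)) * ?D)"
    unfolding Suc r by (simp add: divide_simps del: of_nat_Suc)
  finally show ?case
    using nz by (subst (asm) mult_left_cancel) (simp_all del: of_nat_Suc)
qed

text \<open>As Re c > 0, c + n is no larger in modulus than 2c + n, so the quotient of consecutive
  coefficients is at least (n + 1)/2 and tends to infinity.\<close>

lemma kummer_fps_conv_radius:
  assumes "Re c > 0"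
  shows "fps_conv_radius (kummer_fps c) = \<infinity>"
proof -
  have ratio: "norm (fps_nth (kummer_fps c) n) / norm (fps_nth (kummer_fps c) (Suc n))
      = real (Suc n) * norm (2 * c + of_nat n) / (2 * norm (c + of_nat n))" for n
  proof -
    have nz: "c + of_nat n \<notin> \<int>\<^sub>\<le>\<^sub>0" "2 * c + of_nat n \<notin> \<int>\<^sub>\<le>\<^sub>0" "c + of_nat n \<noteq> 0" "2 * c + of_nat n \<noteq> 0"
      for n using assms by (auto elim!: nonpos_Ints_cases simp: complex_eq_iff)
    have "fps_nth (kummer_fps c) n \<noteq> 0" for n
      using nz[of n] by (simp add: kummer_fps_def Gamma_eq_zero_iff rGamma_eq_zero_iff)
    moreover have "real (Suc n) * norm (2 * c + of_nat n) * norm (fps_nth (kummer_fps c) (Suc n))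
        = 2 * norm (c + of_nat n) * norm (fps_nth (kummer_fps c) n)"
      using arg_cong[OF kummer_fps_rec[OF assms, of n], of norm] unfolding norm_mult norm_of_nat by simp
    ultimately show ?thesis using nz by (simp add: divide_simps mult_ac del: of_nat_Suc)
  qed
  have "filterlim (\<lambda>n. norm (fps_nth (kummer_fps c) n) / norm (fps_nth (kummer_fps c) (Suc n))) at_top sequentially"
  proof (rule filterlim_at_top_mono)
    show "filterlim (\<lambda>n. real (Suc n) / 2) at_top sequentially" by real_asymp
    show "\<forall>\<^sub>F n in sequentially. real (Suc n) / 2
        \<le> norm (fps_nth (kummer_fps c) n) / norm (fps_nth (kummer_fps c) (Suc n))"
    proof (rule always_eventually, rule allI)
      fix n
      have "c + of_nat n \<noteq> 0" using assms by (auto simp: complex_eq_iff)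
      moreover have "norm (c + of_nat n) \<le> norm (2 * c + of_nat n)"
        using assms unfolding cmod_def by (intro real_sqrt_le_mono add_mono) (auto intro!: power_mono simp: power_mult_distrib)
      ultimately have "1 \<le> norm (2 * c + of_nat n) / norm (c + of_nat n)" by simp
      from mult_left_mono[OF this, of "real (Suc n) / 2"]
      show "real (Suc n) / 2 \<le> norm (fps_nth (kummer_fps c) n) / norm (fps_nth (kummer_fps c) (Suc n))"
        unfolding ratio by simp
    qed
  qed
  then have "(\<lambda>n. ereal (norm (fps_nth (kummer_fps c) n) / norm (fps_nth (kummer_fps c) (Suc n)))) \<longlonglongrightarrow> \<infinity>"
    by (simp add: tendsto_PInfty_eq_at_top)
  then show ?thesis
    unfolding fps_conv_radius_def by (intro conv_radius_ratio_limit_ereal_nonzero) auto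
qed

text \<open>Infinite radii of convergence turn the identity of formal series into one of functions;
  the odd terms drop out by reindexing.\<close>

lemma kummer_second:
  assumes "Re c > 0"
  shows "exp (\<i> * z) * (\<Sum>k. (-2 * \<i>) ^ k * Gamma (c + of_nat k) * rGamma (2 * c + of_nat k) / fact k * z ^ k)
     = 2 powr (1 - 2 * c) * of_real (sqrt pi) *
       (\<Sum>k. (-1) ^ k * (z / 2) ^ (2 * k) / fact k * rGamma (c + 1/2 + of_nat k))"
proof -
  let ?D = "2 powr (1 - 2 * c) * of_real (sqrt pi) :: complex"
  have rad: "fps_conv_radius (kummer_fps c) = \<infinity>" using kummer_fps_conv_radius[OF assms] .
  have rad2: "fps_conv_radius (bessel_fps c) = \<infinity>"
    using fps_conv_radius_mult[of "fps_exp \<i>" "kummer_fps c"] by (simp add: rad bessel_fps_def)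
  have "exp (\<i> * z) * (\<Sum>k. (-2 * \<i>) ^ k * Gamma (c + of_nat k) * rGamma (2 * c + of_nat k) / fact k * z ^ k)
      = eval_fps (fps_exp \<i>) z * eval_fps (kummer_fps c) z"
    by (subst eval_fps_exp) (simp add: eval_fps_def kummer_fps_def)
  also have "\<dots> = eval_fps (bessel_fps c) z"
    unfolding bessel_fps_def by (rule eval_fps_mult[symmetric]) (simp_all add: rad)
  finally have 1: "exp (\<i> * z) * (\<Sum>k. (-2 * \<i>) ^ k * Gamma (c + of_nat k)
      * rGamma (2 * c + of_nat k) / fact k * z ^ k)
      = eval_fps (bessel_fps c) z" .
  have "(\<lambda>n. fps_nth (bessel_fps c) n * z ^ n) sums eval_fps (bessel_fps c) z"
    by (rule sums_eval_fps) (simp add: rad2)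
  then have "(\<lambda>k. fps_nth (bessel_fps c) (2 * k) * z ^ (2 * k)) sums eval_fps (bessel_fps c) z"
  proof (subst (asm) sums_mono_reindex[of "\<lambda>k. 2 * k", symmetric])
    show "strict_mono (\<lambda>k::nat. 2 * k)" by (auto simp: strict_mono_def)
    fix n assume "n \<notin> range (\<lambda>k::nat. 2 * k)"
    then have "odd n" by (auto elim!: evenE)
    then show "fps_nth (bessel_fps c) n * z ^ n = 0"
      using bessel_fps_odd[OF assms] by (auto elim!: oddE)
  qed simp
  then have "(\<lambda>k. ?D * ((-1) ^ k * (z / 2) ^ (2 * k) / fact k * rGamma (c + 1/2 + of_nat k)))
      sums eval_fps (bessel_fps c) z"
    unfolding bessel_fps_even[OF assms] power_divide power_mult by (simp add: mult_ac)
  then have "(\<lambda>k. (-1) ^ k * (z / 2) ^ (2 * k) / fact k * rGamma (c + 1/2 + of_nat k))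
      sums (eval_fps (bessel_fps c) z / ?D)"
    using sums_divide[of _ _ ?D] by fastforce
  then show ?thesis unfolding 1 by (simp add: sums_unique[symmetric])
qed

subsection \<open>Integration of the kernel\<close>

text \<open>The substitution sends the right half of the circle parameter to the left half of the
  x-interval and conversely, each with Jacobian 2. The values at 0 and at both ends are immaterial.
  The codomain is general so that the lemma applies to a complex function and to its norm.\<close>

lemma has_integral_half_angle:
  fixes G H :: "real \<Rightarrow> 'a::banach"
  assumes H: "(H has_integral I) {-pi/2..pi/2}"
    and pos: "\<And>t. 0 < t \<Longrightarrow> t < pi \<Longrightarrow> G t = H ((t - pi) / 2)"
    and neg: "\<And>t. -pi < t \<Longrightarrow> t < 0 \<Longrightarrow> G t = H ((t + pi) / 2)"
  shows "(G has_integral 2 *\<^sub>R I) {-pi..pi}"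
proof -
  define I1 I2 where "I1 = integral {-pi/2..0} H" and "I2 = integral {0..pi/2} H"
  have "H integrable_on {-pi/2..0}" "H integrable_on {0..pi/2}"
    by (rule integrable_on_subinterval[of H "{-pi/2..pi/2}"]; use H in auto)+
  then have H1: "(H has_integral I1) {-pi/2..0}" and H2: "(H has_integral I2) {0..pi/2}"
    by (auto simp: I1_def I2_def)
  have I: "I2 + I1 = I"
    using has_integral_unique[OF has_integral_combine[OF _ _ H1 H2] H] by (simp add: add.commute)
  have "((\<lambda>t. H ((t - pi) / 2)) has_integral 2 *\<^sub>R I1) {0..pi}"
    using has_integral_affinity[OF H1[folded cbox_interval], of "1/2" "-pi/2"]
    by (simp add: image_affinity_atLeastAtMost diff_divide_distrib)
  then have 1: "(G has_integral 2 *\<^sub>R I1) {0..pi}"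
    by (rule has_integral_spike_finite[of "{0, pi}", rotated 2]) (auto simp: pos)
  have "((\<lambda>t. H ((t + pi) / 2)) has_integral 2 *\<^sub>R I2) {-pi..0}"
    using has_integral_affinity[OF H2[folded cbox_interval], of "1/2" "pi/2"]
    by (simp add: image_affinity_atLeastAtMost_diff add_divide_distrib)
  then have 2: "(G has_integral 2 *\<^sub>R I2) {-pi..0}"
    by (rule has_integral_spike_finite[of "{-pi, 0}", rotated 2]) (auto simp: neg)
  from has_integral_combine[OF _ _ 2 1] show ?thesis
    by (simp add: I[symmetric] scaleR_add_right)
qed

lemma absolutely_integrable_half_angle:
  fixes G H :: "real \<Rightarrow> complex"
  assumes H: "H absolutely_integrable_on {-pi/2..pi/2}"
    and pos: "\<And>t. 0 < t \<Longrightarrow> t < pi \<Longrightarrow> G t = H ((t - pi) / 2)"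
    and neg: "\<And>t. -pi < t \<Longrightarrow> t < 0 \<Longrightarrow> G t = H ((t + pi) / 2)"
  shows "G absolutely_integrable_on {-pi..pi}"
    and "integral {-pi..pi} G = 2 * integral {-pi/2..pi/2} H"
proof -
  from H have "H integrable_on {-pi/2..pi/2}" "(\<lambda>x. norm (H x)) integrable_on {-pi/2..pi/2}"
    by (auto simp: absolutely_integrable_on_def)
  then have "(H has_integral (integral {-pi/2..pi/2} H)) {-pi/2..pi/2}"
      and "((\<lambda>x. norm (H x)) has_integral (integral {-pi/2..pi/2} (\<lambda>x. norm (H x)))) {-pi/2..pi/2}"
    by (auto intro: integrable_integral)
  from has_integral_half_angle[OF this(1) pos neg]
    has_integral_half_angle[OF this(2), of "\<lambda>t. norm (G t)"] pos neg
  have 1: "(G has_integral 2 *\<^sub>R integral {-pi/2..pi/2} H) {-pi..pi}"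
    and 2: "((\<lambda>t. norm (G t)) has_integral 2 *\<^sub>R integral {-pi/2..pi/2} (\<lambda>x. norm (H x))) {-pi..pi}"
    by simp_all
  from 1 2 show "G absolutely_integrable_on {-pi..pi}"
    by (auto simp: absolutely_integrable_on_def)
  from 1 show "integral {-pi..pi} G = 2 * integral {-pi/2..pi/2} H"
    by (simp add: integral_unique scaleR_conv_of_real)
qed

text \<open>Termwise integration by domination: since cos x lies between 0 and 1, raising the
  exponent by 2n only lowers the bound, so the n-th term is at most \<open>norm (c n)\<close> times
  one integrable function.\<close>

lemma cos_kernel_series:
  fixes c :: "nat \<Rightarrow> complex"
  assumes b: "Re b > -1" and c: "summable (\<lambda>n. norm (c n))"
  shows "(\<lambda>x. \<Sum>n. c n * cos_kernel (b + 2 * of_nat n) q x) absolutely_integrable_on {-pi/2..pi/2}"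
    and "(\<lambda>n. c n * cos_integral (b + 2 * of_nat n) q) sums
           integral {-pi/2..pi/2} (\<lambda>x. \<Sum>n. c n * cos_kernel (b + 2 * of_nat n) q x)"
proof -
  let ?S = "{-pi/2..pi/2}"
  have S: "?S \<in> sets lebesgue" by simp
  let ?f = "\<lambda>n x. c n * cos_kernel (b + 2 * of_nat n) q x"
  define g where "g = (\<lambda>x. exp (\<bar>Im q\<bar> * (pi / 2)) * cos x powr Re b)"
  have le: "norm (?f n x) \<le> norm (c n) * g x" if x: "x \<in> ?S" for n x
  proof -
    have c0: "0 \<le> cos x" using x by (auto simp: cos_ge_zero)
    have "cos x powr Re (b + 2 * of_nat n) \<le> cos x powr Re b"
      using c0 by (intro powr_mono') auto
    then have "norm (cos_kernel (b + 2 * of_nat n) q x) \<le> g x"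
      unfolding g_def by (intro order.trans[OF norm_cos_kernel_le[OF x]] mult_left_mono) auto
    then show ?thesis by (simp add: norm_mult mult_left_mono)
  qed
  have gint: "g absolutely_integrable_on ?S"
    unfolding g_def using integrable_cmul[OF cos_powr_integrable[OF b], of "exp (\<bar>Im q\<bar> * (pi / 2))"]
    by (intro nonnegative_absolutely_integrable_1) auto
  then have gint: "integrable (lebesgue_on ?S) g"
    by (rule absolutely_integrable_imp_integrable) simp
  have fabs: "?f n absolutely_integrable_on ?S" for n
    using b by (intro set_integrable_mult_right cos_kernel_absolutely_integrable) auto
  then have f: "integrable (lebesgue_on ?S) (?f n)" for n
    by (rule absolutely_integrable_imp_integrable) simp
  have sum: "AE x in lebesgue_on ?S. summable (\<lambda>n. norm (?f n x))"
  proof (rule AE_I2)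
    fix x assume "x \<in> space (lebesgue_on ?S)"
    then have "x \<in> ?S" by simp
    from le[OF this] show "summable (\<lambda>n. norm (?f n x))"
      by (intro summable_comparison_test[OF _ summable_mult2[OF c, of "g x"]]) auto
  qed
  have sumint: "summable (\<lambda>n. \<integral>x. norm (?f n x) \<partial>lebesgue_on ?S)"
  proof (rule summable_comparison_test[OF _ summable_mult2[OF c]], intro exI allI impI)
    fix n :: nat
    have "(\<integral>x. norm (?f n x) \<partial>lebesgue_on ?S)
        \<le> (\<integral>x. norm (c n) * g x \<partial>lebesgue_on ?S)"
      using le by (intro integral_mono integrable_norm f integrable_mult_right gint) auto
    then show "norm (\<integral>x. norm (?f n x) \<partial>lebesgue_on ?S)
        \<le> norm (c n) * (\<integral>x. g x \<partial>lebesgue_on ?S)"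
      by simp
  qed
  have int: "integrable (lebesgue_on ?S) (\<lambda>x. \<Sum>n. ?f n x)"
    by (rule integrable_suminf[OF f sum sumint])
  then show "(\<lambda>x. \<Sum>n. ?f n x) absolutely_integrable_on ?S"
    by (simp add: set_integrable_def integrable_restrict_space)
  have "(\<integral>x. ?f n x \<partial>lebesgue_on ?S) = c n * cos_integral (b + 2 * of_nat n) q" for n
    by (subst lebesgue_integral_eq_integral[OF f]) (simp_all add: cos_integral_def)
  then show "(\<lambda>n. c n * cos_integral (b + 2 * of_nat n) q) sums integral ?S (\<lambda>x. \<Sum>n. ?f n x)"
    using sums_integral[OF f sum sumint] lebesgue_integral_eq_integral[OF int S]
    by (simp only:)
qed

text \<open>The point t = 0 is left out because \<open>sgn 0 = 0\<close> would give x = 0, whereas 1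
  - cos t = 0 corresponds to x = pi/2 or -pi/2.\<close>

lemma bessel_kernel_expand:
  fixes l :: nat and \<nu> z :: complex
  assumes t: "-pi < t" "t < pi" "t \<noteq> 0"
  defines "a \<equiv> cfrac \<nu>" and "x \<equiv> (t - pi * sgn t) / 2"
  shows "bessel_kernel \<nu> z t * exp (\<i> * of_nat l * of_real t) =
     exp (\<i> * of_real pi * \<nu> / 2) / (2 * of_real pi)
      * (cpow (of_real (norm z)) a * exp (\<i> * a * of_real (Arg z - pi / 2)))
      * exp (\<i> * z) * (-1) ^ l * 2 powr a *
     (\<Sum>n. rGamma (a + of_nat n + 1) * (-2 * \<i> * z) ^ n *
        cos_kernel (2 * a + 2 * of_nat n) (2 * (\<nu> + of_nat l)) x)"
proof -
  define y where "y = 1 - cos t"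
  let ?e = "exp (\<i> * (2 * (\<nu> + of_nat l)) * of_real x)"
  let ?b = "\<lambda>n. (- \<i> * z * of_real y) ^ n * rGamma (a + of_nat n + 1)"
  let ?c = "\<lambda>n. rGamma (a + of_nat n + 1) * (-2 * \<i> * z) ^ n
      * cos_kernel (2 * a + 2 * of_nat n) (2 * (\<nu> + of_nat l)) x"
  have ang: "ang t = t" using t by (intro ang_eq) auto
  have x: "x \<in> {-pi/2<..<pi/2}" using t by (auto simp: x_def sgn_if)
  have cx: "cos x > 0" using x by (intro cos_gt_zero_pi) auto
  have t2: "t = 2 * x + pi * sgn t" by (simp add: x_def field_simps)
  have "cos t = - cos (2 * x)"
    using t by (subst t2) (cases "t > 0"; simp add: sgn_if)
  then have y: "y = 2 * (cos x)\<^sup>2"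
    by (simp add: y_def cos_double_cos)
  have y0: "y > 0" using cx by (simp add: y)
  have sg: "exp (\<i> * of_nat l * of_real (pi * sgn t)) = (-1) ^ l"
  proof -
    have "exp (\<i> * of_nat l * of_real (pi * sgn t)) = exp (\<i> * of_real (pi * sgn t)) ^ l"
      by (simp add: exp_of_nat_mult[symmetric] mult_ac)
    also have "exp (\<i> * of_real (pi * sgn t)) = -1"
      using t by (cases "t > 0") (simp_all add: sgn_if exp_minus)
    finally show ?thesis .
  qed
  \<comment> \<open>The shift by pi is already cancelled in the exponent of \<open>\<nu>\<close>.
    Only the factor with \<open>l\<close> sees it, and as \<open>l\<close> is an integer both halves
    give the same sign.\<close>
  have e1: "exp (\<i> * \<nu> * of_real (t - pi * sgn t)) * exp (\<i> * of_nat l * of_real t)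
      = (-1) ^ l * ?e"
  proof -
    have d: "t - pi * sgn t = 2 * x" and "complex_of_real t = of_real (2 * x + pi * sgn t)"
      using t2 by simp_all
    then have ct: "complex_of_real t = 2 * of_real x + of_real (pi * sgn t)" by simp
    show ?thesis unfolding d ct sg[symmetric] exp_add[symmetric]
      by (rule arg_cong[of _ _ exp]) (simp add: algebra_simps)
  qed
  have e2: "exp (\<i> * z * of_real (cos t)) * exp (-(- \<i> * z * of_real y)) = exp (\<i> * z)"
    by (simp add: exp_add[symmetric] y_def algebra_simps)
  \<comment> \<open>Since y > 0, it splits off from the modulus and leaves the phase to z
    alone.\<close>
  have nrm: "cpow (of_real (norm (- \<i> * z * of_real y))) a = cpow (of_real (norm z)) a * of_real y powr a"
    using y0 by (simp add: cpow_def norm_mult powr_times_real)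
  have yp: "of_real y powr a = 2 powr a * of_real (cos x) powr (2 * a)"
  proof -
    have "of_real (cos x) powr (2 * a) = (of_real (cos x) powr a * of_real (cos x) powr a :: complex)"
      unfolding mult_2 by (rule powr_add)
    also have "\<dots> = (of_real (cos x) * of_real (cos x)) powr a"
      using cx by (intro powr_times_real_left[symmetric]) auto
    also have "2 powr a * \<dots> = (2 * (of_real (cos x) * of_real (cos x))) powr a"
      by (intro powr_times_real_left[symmetric]) auto
    finally show ?thesis unfolding y power2_eq_square by simp
  qed
  have term_eq: "of_real y powr a * ?b n * ?e = 2 powr a * ?c n" for n
  proof -
    have "of_real (cos x) powr (2 * a + 2 * of_nat n) = of_real (cos x) powr (2 * a) * of_real (cos x) ^ (2 * n)"
      using cx powr_nat[of "of_real (cos x)" "2 * n"] by (simp add: powr_add)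
    moreover have "(- \<i> * z * of_real y) ^ n = (-2 * \<i> * z) ^ n * of_real (cos x) ^ (2 * n)"
      unfolding power_mult power_mult_distrib[symmetric] by (simp add: y mult_ac)
    ultimately show ?thesis unfolding yp cos_kernel_def by simp
  qed
  have sm: "summable ?b"
    by (subst mult.commute) (rule summable_norm_cancel[OF summable_rGamma_power])
  have "of_real y powr a * (\<Sum>n. ?b n) * ?e = (\<Sum>n. of_real y powr a * ?b n * ?e)"
    unfolding suminf_mult[OF sm, symmetric] by (rule suminf_mult2[OF summable_mult[OF sm]])
  also have "\<dots> = 2 powr a * (\<Sum>n. ?c n)"
    unfolding term_eq
  proof (rule suminf_mult)
    have "summable (\<lambda>n. 2 powr a * ?c n)"
      unfolding term_eq[symmetric] using sm by (intro summable_mult summable_mult2)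
    then show "summable ?c"
      by (subst (asm) summable_cmult_iff) simp
  qed
  finally have S: "of_real y powr a * (\<Sum>n. ?b n) * ?e = 2 powr a * (\<Sum>n. ?c n)" .
  let ?C = "exp (\<i> * of_real pi * \<nu> / 2) / (2 * of_real pi)"
  let ?K = "cpow (of_real (norm z)) a" and ?E = "exp (\<i> * a * of_real (Arg z - pi / 2))"
  have "bessel_kernel \<nu> z t * exp (\<i> * of_nat l * of_real t) =
     ?C * (?K * ?E) * (exp (\<i> * z * of_real (cos t)) * exp (-(- \<i> * z * of_real y)))
      * (exp (\<i> * \<nu> * of_real (t - pi * sgn t))
          * exp (\<i> * of_nat l * of_real t)) * (of_real y powr a * (\<Sum>n. ?b n))"
    unfolding bessel_kernel_def Let_def ang reg_lower_gamma_def gamma_star_def a_def[symmetric] y_def[symmetric] nrm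
    by (simp only: mult_ac)
  also have "\<dots> = ?C * (?K * ?E) * exp (\<i> * z) * (-1) ^ l * (of_real y powr a * (\<Sum>n. ?b n) * ?e)"
    unfolding e1 e2 by (simp only: mult_ac)
  finally show ?thesis unfolding S by (simp only: mult.assoc)
qed

section \<open>Powers, summation of the integrated series, and conclusion\<close>

lemma cpow_add_of_nat:
  assumes "a = 0 \<or> w \<noteq> 0"
  shows "cpow w (a + of_nat n) = cpow w a * w ^ n"
\<comment> \<open>At w = 0 with a = 0 the convention \<open>cpow 0 0 = 1\<close> is what agrees with
  \<open>w ^ 0\<close>. For a different from 0 the base must be nonzero, because a + n may be
  0.\<close>
proof (cases "a = 0")
  case True
  then show ?thesis by (cases "n = 0") (simp_all add: cpow_def powr_nat')
next
  case False
  with assms have "w powr (a + of_nat n) = w powr a * w ^ n" "w \<noteq> 0"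
    by (simp_all add: powr_add powr_nat)
  then show ?thesis using False by (auto simp: cpow_def)
qed

lemma cpow_half: "cpow z a = 2 powr a * cpow (z / 2) a"
  using powr_times_real_left[of 2 "z / 2" a] by (simp add: cpow_def)

text \<open>The parameters of the n-th integral differ by 2(n - N). For n < N it vanishes by
  \<open>cos_integral_zero\<close>; for n = k + N Cauchy's formula applies, and the duplication
  formula makes \<open>rGamma (a + of_nat n + 1)\<close> cancel against half of Gamma(2\<mu> + 2k +
  1).\<close>

lemma cos_integral_series:
  fixes N :: nat
  assumes a: "Re a > -1/2"
  defines "\<mu> \<equiv> a + of_nat N"
  assumes sums: "(\<lambda>n. rGamma (a + of_nat n + 1) * w ^ n * cos_integral (2 * a + 2 * of_nat n) (2 * \<mu>)) sums S"
  shows "S = of_real (sqrt pi) * w ^ N * (\<Sum>k. w ^ k * Gamma (\<mu> + 1/2 + of_nat k)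
      * rGamma (2 * (\<mu> + 1/2) + of_nat k) / fact k)"
proof -
  let ?f = "\<lambda>n. rGamma (a + of_nat n + 1) * w ^ n * cos_integral (2 * a + 2 * of_nat n) (2 * \<mu>)"
  have zero: "?f n = 0" if lt: "n < N" for n
  proof -
    obtain j where j: "N = n + Suc j" using less_imp_Suc_add[OF lt] by auto
    have "cos_integral (2 * a + 2 * of_nat n) (2 * a + 2 * of_nat n + 2 * of_nat (Suc j)) = 0"
      using a by (intro cos_integral_zero) simp
    then show ?thesis by (simp add: \<mu>_def j algebra_simps)
  qed
  have shift: "?f (k + N) = of_real (sqrt pi) * w ^ N * (w ^ k * Gamma (\<mu> + 1/2 + of_nat k)
      * rGamma (2 * (\<mu> + 1/2) + of_nat k) / fact k)" for k
  proof -
    let ?u = "\<mu> + of_nat k + 1/2"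
    have mu: "Re \<mu> > -1/2" using a by (simp add: \<mu>_def)
    have nz: "?u \<notin> \<int>\<^sub>\<le>\<^sub>0" "?u + 1/2 \<notin> \<int>\<^sub>\<le>\<^sub>0"
      using mu by (auto elim!: nonpos_Ints_cases simp: complex_eq_iff)
    have "Gamma ?u * Gamma (?u + 1/2) = 2 powr (1 - 2 * ?u) * of_real (sqrt pi) * Gamma (2 * ?u)"
      using Gamma_legendre_duplication[OF nz] Ln_of_real[of 2] by (simp add: powr_def)
    also have "2 powr (1 - 2 * ?u) = 1 / 2 powr (2 * \<mu> + 2 * of_nat k)"
      by (simp add: powr_minus_divide[symmetric] algebra_simps)
    finally have dup: "Gamma (2 * ?u) / 2 powr (2 * \<mu> + 2 * of_nat k) = Gamma ?u * Gamma (?u + 1/2) / of_real (sqrt pi)"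
      by (simp add: field_simps)
    have pi: "of_real pi = of_real (sqrt pi) * (of_real (sqrt pi) :: complex)"
      by (simp flip: of_real_mult)
    have inv: "rGamma (?u + 1/2) * Gamma (?u + 1/2) = 1"
      using nz by (simp add: rGamma_inverse_Gamma Gamma_eq_zero_iff)
    have int: "cos_integral (2 * \<mu> + 2 * of_nat k) (2 * \<mu>) =
        of_real pi * (Gamma (2 * ?u) / (2 powr (2 * \<mu> + 2 * of_nat k))) * rGamma (2 * (\<mu> + 1/2) + of_nat k) / fact k"
      using cos_integral_Gamma[of "2 * \<mu>" k] mu by (simp add: ring_distribs add_ac)
    have alg: "r * (s * s * (g * g' / s) * R / F) = (r * g') * (s * g * R / F)"
      if "s \<noteq> 0" for r s g g' R F :: complex
      using that by simp
    have "rGamma (?u + 1/2) * cos_integral (2 * \<mu> + 2 * of_nat k) (2 * \<mu>)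
       = of_real (sqrt pi) * Gamma ?u * rGamma (2 * (\<mu> + 1/2) + of_nat k) / fact k"
      unfolding int dup pi by (subst alg) (simp_all only: inv mult_1_left, simp)
    moreover have "?u + 1/2 = a + of_nat (k + N) + 1" "2 * \<mu> + 2 * of_nat k
        = 2 * a + 2 * of_nat (k + N)" "?u = \<mu> + 1/2 + of_nat k"
      by (simp_all add: \<mu>_def algebra_simps)
    ultimately have "rGamma (a + of_nat (k + N) + 1) * cos_integral (2 * a + 2 * of_nat (k + N)) (2 * \<mu>)
       = of_real (sqrt pi) * Gamma (\<mu> + 1/2 + of_nat k) * rGamma (2 * (\<mu> + 1/2) + of_nat k) / fact k"
      by (simp only:)
    then have "w ^ (k + N) * (rGamma (a + of_nat (k + N) + 1) * cos_integral (2 * a + 2 * of_nat (k + N)) (2 * \<mu>))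
       = w ^ (k + N) * (of_real (sqrt pi) * Gamma (\<mu> + 1/2 + of_nat k) * rGamma (2 * (\<mu> + 1/2) + of_nat k) / fact k)"
      by (rule arg_cong)
    then show ?thesis by (simp only: power_add mult_ac times_divide_eq_left times_divide_eq_right)
  qed
  have "(\<lambda>k. ?f (k + N)) sums S"
    using sums by (subst sums_zero_iff_shift) (use zero in auto)
  then have s: "(\<lambda>k. of_real (sqrt pi) * w ^ N * (w ^ k * Gamma (\<mu> + 1/2 + of_nat k)
      * rGamma (2 * (\<mu> + 1/2) + of_nat k) / fact k)) sums S"
    unfolding shift .
  \<comment> \<open>The prefactor is 0 when w = 0 and N > 0, and then both sides are 0. Otherwise
    division yields convergence of the remaining series together with its value.\<close>
  show ?thesis
  proof (cases "of_real (sqrt pi) * w ^ N = 0")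
    case True
    then have "(\<lambda>k. 0) sums S" using s by (simp only: mult_zero_left)
    then have "S = 0" using sums_unique2 sums_zero by blast
    with True show ?thesis by (simp only: mult_zero_left)
  next
    case False
    from sums_divide[OF s, of "of_real (sqrt pi) * w ^ N"]
    have "(\<lambda>k. w ^ k * Gamma (\<mu> + 1/2 + of_nat k) * rGamma (2 * (\<mu> + 1/2) + of_nat k) / fact k)
        sums (S / (of_real (sqrt pi) * w ^ N))"
      unfolding nonzero_mult_div_cancel_left[OF False] .
    from sums_unique[OF this, symmetric] show ?thesis
      by (simp only: nonzero_mult_div_cancel_left[OF False] times_divide_eq_right)
  qed
qed

text \<open>Since \<open>integral\<close> is 0 by convention for a nonintegrable function, absolute
  integrability is asserted beside the identity.\<close>

theorem theorem3p1:
  fixes l :: nat and \<nu> z :: complex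
  assumes "Re \<nu> > -1/2"
    and "\<nu> \<notin> \<nat> \<longrightarrow> z \<notin> \<real>\<^sub>\<le>\<^sub>0"
  shows "(\<lambda>\<theta>. bessel_kernel \<nu> z \<theta> * exp (\<i> * of_nat l * of_real \<theta>))
           absolutely_integrable_on {-pi..pi} \<and>
         bessel_J (\<nu> + of_nat l) z =
           (-\<i>) ^ l * integral {-pi..pi}
             (\<lambda>\<theta>. bessel_kernel \<nu> z \<theta> * exp (\<i> * of_nat l * of_real \<theta>))"
proof -
  define m where "m = nat (trunc (Re \<nu>))"
  define a where "a = cfrac \<nu>"
  \<comment> \<open>For Re \<nu> between -1/2 and 0 the ceiling is 0, so the integer part is a
    natural number in all cases.\<close>
  have trunc: "trunc (Re \<nu>) = int m"
    using assms(1) by (auto simp: m_def trunc_def)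
  have nu: "\<nu> = a + of_nat m" by (simp add: a_def cfrac_def trunc)
  have a: "Re a > -1/2"
  proof (cases "Re \<nu> \<ge> 0")
    case True
    moreover have "Re a = Re \<nu> - of_int \<lfloor>Re \<nu>\<rfloor>"
      using True by (simp add: a_def cfrac_def trunc_def)
    ultimately show ?thesis using of_int_floor_le[of "Re \<nu>"] by linarith
  next
    case False
    with assms(1) have "\<lceil>Re \<nu>\<rceil> = 0" by (intro ceiling_unique) auto
    with False assms(1) show ?thesis by (simp add: a_def cfrac_def trunc_def)
  qed
  have "a = 0" if "\<nu> \<in> \<nat>"
    using that by (auto elim!: Nats_cases simp: a_def cfrac_def trunc_def)
  \<comment> \<open>If z = 0, the hypothesis forces \<open>\<nu>\<close> to be a natural number, and
    then a = 0.\<close>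
  then have az: "a = 0 \<or> z \<noteq> 0" using assms(2) by auto
  define N where "N = m + l"
  define \<mu> where "\<mu> = a + of_nat N"
  have mu: "\<nu> + of_nat l = \<mu>" by (simp add: nu \<mu>_def N_def)
  define w where "w = -2 * \<i> * z"
  define D where "D = exp (\<i> * of_real pi * \<nu> / 2) / (2 * of_real pi)
      * (cpow (of_real (norm z)) a * exp (\<i> * a * of_real (Arg z - pi / 2)))
      * exp (\<i> * z) * (-1) ^ l * 2 powr a"
  define f where "f = (\<lambda>x. \<Sum>n. rGamma (a + of_nat n + 1) * w ^ n
      * cos_kernel (2 * a + 2 * of_nat n) (2 * \<mu>) x)"
  define G where "G = (\<lambda>\<theta>. bessel_kernel \<nu> z \<theta> * exp (\<i> * of_nat l * of_real \<theta>))"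
  have G_eq: "G t = D * f ((t - pi * sgn t) / 2)" if "-pi < t" "t < pi" "t \<noteq> 0" for t
    unfolding G_def D_def f_def a_def w_def mu[symmetric] by (rule bessel_kernel_expand[OF that])
  have pos: "G t = D * f ((t - pi) / 2)" if "0 < t" "t < pi" for t
    using G_eq[of t] that by simp
  have neg: "G t = D * f ((t + pi) / 2)" if "-pi < t" "t < 0" for t
    using G_eq[of t] that by simp
  \<comment> \<open>The bound Re \<nu> > -1/2 enters here: 1 - cos \<theta> contributes cos^(2a) x,
    whose exponent must have real part above -1.\<close>
  have a2: "Re (2 * a) > -1" using a by simp
  have f_int: "f absolutely_integrable_on {-pi/2..pi/2}"
    and f_sums: "(\<lambda>n. rGamma (a + of_nat n + 1) * w ^ n * cos_integral (2 * a + 2 * of_nat n) (2 * \<mu>))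
      sums integral {-pi/2..pi/2} f"
    using cos_kernel_series[OF a2 summable_rGamma_power[of a w], of "2 * \<mu>"] by (simp_all add: f_def)
  have Df: "(\<lambda>x. D * f x) absolutely_integrable_on {-pi/2..pi/2}"
    using f_int by (rule set_integrable_mult_right)
  have G_int: "G absolutely_integrable_on {-pi..pi}"
    and G_integral: "integral {-pi..pi} G = 2 * (D * integral {-pi/2..pi/2} f)"
    using absolutely_integrable_half_angle[of "\<lambda>x. D * f x" G, OF Df] pos neg by simp_all
  define B where "B = (\<Sum>k. (-1) ^ k * (z / 2) ^ (2 * k) / fact k * rGamma (\<mu> + of_nat k + 1))"
  have "integral {-pi/2..pi/2} f = of_real (sqrt pi) * w ^ N *
      (\<Sum>k. w ^ k * Gamma (\<mu> + 1/2 + of_nat k) * rGamma (2 * (\<mu> + 1/2) + of_nat k) / fact k)"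
    using cos_integral_series[OF a f_sums[unfolded \<mu>_def]] by (simp add: \<mu>_def)
  also have "(\<Sum>k. w ^ k * Gamma (\<mu> + 1/2 + of_nat k) * rGamma (2 * (\<mu> + 1/2) + of_nat k) / fact k)
      = (\<Sum>k. (-2 * \<i>) ^ k * Gamma (\<mu> + 1/2 + of_nat k) * rGamma (2 * (\<mu> + 1/2) + of_nat k) / fact k * z ^ k)"
    unfolding w_def power_mult_distrib[of _ z]
    by (simp only: mult_ac times_divide_eq_left times_divide_eq_right)
  finally have "exp (\<i> * z) * integral {-pi/2..pi/2} f = of_real (sqrt pi) * w ^ N *
      (exp (\<i> * z) * (\<Sum>k. (-2 * \<i>) ^ k * Gamma (\<mu> + 1/2 + of_nat k)
          * rGamma (2 * (\<mu> + 1/2) + of_nat k) / fact k * z ^ k))"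
    by (simp only: mult_ac)
  \<comment> \<open>Kummer's formula with c = \<mu> + 1/2, so that 2^(1 - 2c) = 2^(-2\<mu>).\<close>
  also have "\<dots> = of_real (sqrt pi) * w ^ N * (2 powr (1 - 2 * (\<mu> + 1/2)) * of_real (sqrt pi) * B)"
    using a by (subst kummer_second) (simp_all add: \<mu>_def B_def add_ac)
  also have "\<dots> = of_real pi * w ^ N * 2 powr (-2 * \<mu>) * B"
    by (simp add: ring_distribs flip: of_real_mult mult.assoc)
  finally have int_f: "exp (\<i> * z) * integral {-pi/2..pi/2} f = of_real pi * w ^ N * 2 powr (-2 * \<mu>) * B" .
  \<comment> \<open>The phase -pi/2 of -i cancels the part of i^\<nu> that belongs to
    \<open>a\<close>, leaving the integer power \<open>\<i> ^ m\<close> and the principal power of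
    z.\<close>
  have phase: "exp (\<i> * of_real pi * \<nu> / 2) * (cpow (of_real (norm z)) a * exp (\<i> * a * of_real (Arg z - pi / 2)))
      = \<i> ^ m * cpow z a"
  proof -
    have "exp (\<i> * of_real pi * of_nat m / 2) = exp (of_nat m * (\<i> * of_real pi / 2))"
      by (simp add: mult_ac)
    also have "\<dots> = \<i> ^ m"
      by (subst exp_of_nat_mult) (simp add: exp_eq_polar)
    finally have m: "exp (\<i> * of_real pi * of_nat m / 2) = \<i> ^ m" .
    have "exp (\<i> * of_real pi * \<nu> / 2) * exp (\<i> * a * of_real (Arg z - pi / 2))
        = exp (\<i> * of_real pi * of_nat m / 2) * exp (\<i> * a * of_real (Arg z))"
      unfolding exp_add[symmetric] nu
      by (rule arg_cong[of _ _ exp]) (simp add: algebra_simps add_divide_distrib)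
    moreover have "cpow (of_real (norm z)) a * exp (\<i> * a * of_real (Arg z)) = cpow z a"
      using az by (auto simp: cpow_def powr_def Ln_of_real Ln_Arg ring_distribs exp_add mult_ac)
    ultimately show ?thesis unfolding m by (metis mult.assoc mult.commute)
  qed
  have wN: "w ^ N = z ^ N * ((- \<i>) ^ N * 2 ^ N)"
    by (simp add: w_def mult_ac flip: power_mult_distrib)
  have "(-\<i>) ^ l * integral {-pi..pi} G = (-\<i>) ^ l * (2 * (D * integral {-pi/2..pi/2} f))"
    unfolding G_integral ..
  also have "\<dots> = ((-\<i>) ^ l * (-1) ^ l) * (\<i> ^ m * cpow z a) * (2 / (2 * of_real pi)) * 2 powr a
      * (exp (\<i> * z) * integral {-pi/2..pi/2} f)"
    unfolding D_def phase[symmetric] by simp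
  also have "\<dots> = (((-\<i>) ^ l * (-1) ^ l) * \<i> ^ m * (- \<i>) ^ N)
      * (2 ^ N * 2 powr a * 2 powr (-2 * \<mu>)) * (cpow z a * z ^ N) * B"
    unfolding int_f wN by simp
  \<comment> \<open>(-i)^l (-1)^l = i^l, and i^l i^m = i^N is inverse to (-i)^N.\<close>
  also have "((-\<i>) ^ l * (-1) ^ l) * \<i> ^ m * (- \<i>) ^ N = 1"
  proof -
    have "((-\<i>) ^ l * (-1) ^ l) * \<i> ^ m * (- \<i>) ^ N = \<i> ^ N * (- \<i>) ^ N"
      by (simp add: N_def power_add flip: power_mult_distrib)
    also have "\<dots> = 1" by (simp flip: power_mult_distrib)
    finally show ?thesis .
  qed
  also have "2 ^ N * 2 powr a * 2 powr (-2 * \<mu>) = 2 powr (- \<mu>)"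
  proof -
    have "2 ^ N * 2 powr a = 2 powr \<mu>" by (simp add: \<mu>_def powr_add powr_nat)
    then show ?thesis by (simp flip: powr_add)
  qed
  also have "cpow z a * z ^ N = cpow z \<mu>"
    unfolding \<mu>_def using az by (rule cpow_add_of_nat[symmetric])
  also have "1 * 2 powr (- \<mu>) * cpow z \<mu> * B = cpow (z / 2) \<mu> * B"
    by (subst cpow_half) (simp add: powr_minus)
  finally have "bessel_J \<mu> z = (-\<i>) ^ l * integral {-pi..pi} G"
    by (simp add: bessel_J_def B_def)
  with G_int show ?thesis by (simp add: mu G_def)
qed

end
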